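(* Let $G=(V,E)$ be an infinite, connected, locally finite graph with bounded degree, equipped with a vertex weight $\omega:V\to\mathbb{R}_+^\star$ and an edge conductance $c:E\to\mathbb{R}_+^\star$. Let $a:E\to\mathbb{R}_+^\star$ be given by $$a_{x,y}=\frac{c_{x,y}}{\omega_x\omega_y}\qquad(\{x,y\}\in E),$$ and assume that $V$ with the metric associated to the distance $\delta_a$ is complete. Then the Laplacian $\Delta_{\omega,c}$, with domain $C_0(V)$, is essentially self-adjoint (as an operator on $l^2_\omega(V)$).
   Context: $G=(V,E)$ is a graph with vertex set $V$ and edge set $E$, whose edges are unordered pairs $\{x,y\}$ of distinct vertices; $x\sim y$ means $\{x,y\}\in E$. The graph has bounded degree if there is an integer $N$ with $\sharp\{y\in V: y\sim x\}\le N$ for every $x\in V$. $\mathbb{R}_+^\star=(0,\infty)$. A function $c$ on $E$ is written $c_{x,y}=c_{y,x}$ for $\{x,y\}\in E$. $C(V)$ is the space of functions $V\to\mathbb{R}$ and $C_0(V)$ the subspace of finitely supported functions. For $\omega:V\to\mathbb{R}_+^\star$, $l^2_\omega(V)=\{f:V\to\mathbb{R}:\sum_{x\in V}\omega_x^2|f(x)|^2<\infty\}$ is a Hilbert space with scalar product $\langle f,g\rangle_{l^2_\omega}=\sum_{x\in V}\omega_x^2f(x)g(x)$. The weighted graph Laplacian with vertex weight $\omega$ and edge conductance $c$ is $$(\Delta_{\omega,c}f)(x)=\frac{1}{\omega_x^2}\sum_{y\sim x}c_{x,y}(f(x)-f(y)).$$ It is symmetric on $C_0(V)\subset l^2_\omega(V)$.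 For $a:E\to\mathbb{R}_+^\star$, the $a$-weighted distance is $\delta_a(x,y)=\inf_{\gamma}L(\gamma)$, the infimum being over all finite edge paths $\gamma: x_1=x,x_2,\dots,x_n=y$ (with $x_i\sim x_{i+1}$) linking $x$ to $y$, where $L(\gamma)=\sum_{1\le i\le n-1}\frac{1}{\sqrt{a_{x_i,x_{i+1}}}}$. An unbounded symmetric linear operator on a Hilbert space is essentially self-adjoint if it has a unique self-adjoint extension. *)

theory Defs
  imports "HOL-Analysis.Analysis"
begin

text \<open>
  A graph has the whole type \<open>'v\<close> as its vertex set; its edge set \<open>E\<close> consists of
  unordered pairs, and functions on edges (\<open>c\<close>, \<open>a\<close>) take the edge \<open>{x, y}\<close> as argument, so that
  \<open>c {x, y} = c {y, x}\<close> holds by construction. Values outside \<open>E\<close> are never used.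
\<close>

definition simple_graph :: "'v set set \<Rightarrow> bool" where
  "simple_graph E \<longleftrightarrow> (\<forall>e\<in>E. \<exists>x y. x \<noteq> y \<and> e = {x, y})"

definition neighbours :: "'v set set \<Rightarrow> 'v \<Rightarrow> 'v set" where
  "neighbours E x = {y. {x, y} \<in> E}"

definition locally_finite :: "'v set set \<Rightarrow> bool" where
  "locally_finite E \<longleftrightarrow> (\<forall>x. finite (neighbours E x))"

definition bounded_degree :: "'v set set \<Rightarrow> bool" where
  "bounded_degree E \<longleftrightarrow> (\<exists>N. \<forall>x. finite (neighbours E x) \<and> card (neighbours E x) \<le> N)"

text \<open>A path is its non-empty list of vertices; \<open>[x]\<close> is a path from \<open>x\<close> to \<open>x\<close>.\<close>

definition edge_paths :: "'v set set \<Rightarrow> 'v \<Rightarrow> 'v \<Rightarrow> 'v list set" where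
  "edge_paths E x y =
     {p. p \<noteq> [] \<and> hd p = x \<and> last p = y \<and> successively (\<lambda>u v. {u, v} \<in> E) p}"

definition connected_graph :: "'v set set \<Rightarrow> bool" where
  "connected_graph E \<longleftrightarrow> (\<forall>x y. edge_paths E x y \<noteq> {})"

definition path_length :: "('v set \<Rightarrow> real) \<Rightarrow> 'v list \<Rightarrow> real" where
  "path_length a p = (\<Sum>i<length p - 1. 1 / sqrt (a {p ! i, p ! Suc i}))"

definition weighted_dist :: "'v set set \<Rightarrow> ('v set \<Rightarrow> real) \<Rightarrow> 'v \<Rightarrow> 'v \<Rightarrow> real" where
  "weighted_dist E a x y = (INF p\<in>edge_paths E x y. path_length a p)"


text \<open>The real Hilbert space of functions on the vertices, with weight \<open>\<omega>\<^sup>2\<close>.\<close>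

definition l2 :: "('v \<Rightarrow> real) \<Rightarrow> ('v \<Rightarrow> real) set" where
  "l2 \<omega> = {f. (\<lambda>x. (\<omega> x)\<^sup>2 * \<bar>f x\<bar>\<^sup>2) summable_on UNIV}"

definition l2_inner :: "('v \<Rightarrow> real) \<Rightarrow> ('v \<Rightarrow> real) \<Rightarrow> ('v \<Rightarrow> real) \<Rightarrow> real" where
  "l2_inner \<omega> f g = (\<Sum>\<^sub>\<infinity>x\<in>UNIV. (\<omega> x)\<^sup>2 * f x * g x)"

definition l2_norm :: "('v \<Rightarrow> real) \<Rightarrow> ('v \<Rightarrow> real) \<Rightarrow> real" where
  "l2_norm \<omega> f = sqrt (l2_inner \<omega> f f)"

definition C0 :: "('v \<Rightarrow> real) set" where
  "C0 = {f. finite {x. f x \<noteq> 0}}"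


text \<open>
  An unbounded operator is a partial map on functions, defined exactly on its domain. Hence
  equality of operators is equality of domains and of values, and \<open>A \<subseteq>\<^sub>m B\<close> says
  that \<open>B\<close> extends \<open>A\<close>.
\<close>

type_synonym 'v operator = "('v \<Rightarrow> real) \<rightharpoonup> ('v \<Rightarrow> real)"

definition linear_operator :: "('v \<Rightarrow> real) \<Rightarrow> 'v operator \<Rightarrow> bool" where
  "linear_operator \<omega> A \<longleftrightarrow>
     dom A \<subseteq> l2 \<omega> \<and> ran A \<subseteq> l2 \<omega> \<and>
     A (\<lambda>x. 0) = Some (\<lambda>x. 0) \<and>
     (\<forall>f g u v. A f = Some u \<longrightarrow> A g = Some v \<longrightarrow>
        A (\<lambda>x. f x + g x) = Some (\<lambda>x. u x + v x)) \<and>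
     (\<forall>r f u. A f = Some u \<longrightarrow> A (\<lambda>x. r * f x) = Some (\<lambda>x. r * u x))"

definition densely_defined :: "('v \<Rightarrow> real) \<Rightarrow> 'v operator \<Rightarrow> bool" where
  "densely_defined \<omega> A \<longleftrightarrow>
     (\<forall>f\<in>l2 \<omega>. \<forall>\<epsilon>>0. \<exists>g\<in>dom A. l2_norm \<omega> (\<lambda>x. f x - g x) < \<epsilon>)"

definition symmetric_operator :: "('v \<Rightarrow> real) \<Rightarrow> 'v operator \<Rightarrow> bool" where
  "symmetric_operator \<omega> A \<longleftrightarrow>
     linear_operator \<omega> A \<and> densely_defined \<omega> A \<and>
     (\<forall>f\<in>dom A. \<forall>g\<in>dom A. l2_inner \<omega> (the (A f)) g = l2_inner \<omega> f (the (A g)))"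

definition is_adjoint_value ::
    "('v \<Rightarrow> real) \<Rightarrow> 'v operator \<Rightarrow> ('v \<Rightarrow> real) \<Rightarrow> ('v \<Rightarrow> real) \<Rightarrow> bool" where
  "is_adjoint_value \<omega> A g h \<longleftrightarrow>
     h \<in> l2 \<omega> \<and> (\<forall>f\<in>dom A. l2_inner \<omega> (the (A f)) g = l2_inner \<omega> f h)"

text \<open>The description below is unique because the adjoint is only used for densely defined \<open>A\<close>.\<close>

definition adjoint_operator :: "('v \<Rightarrow> real) \<Rightarrow> 'v operator \<Rightarrow> 'v operator" where
  "adjoint_operator \<omega> A =
     (\<lambda>g. if g \<in> l2 \<omega> \<and> (\<exists>h. is_adjoint_value \<omega> A g h)
          then Some (THE h. is_adjoint_value \<omega> A g h) else None)"

definition self_adjoint :: "('v \<Rightarrow> real) \<Rightarrow> 'v operator \<Rightarrow> bool" where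
  "self_adjoint \<omega> A \<longleftrightarrow>
     linear_operator \<omega> A \<and> densely_defined \<omega> A \<and> adjoint_operator \<omega> A = A"

definition essentially_self_adjoint :: "('v \<Rightarrow> real) \<Rightarrow> 'v operator \<Rightarrow> bool" where
  "essentially_self_adjoint \<omega> A \<longleftrightarrow>
     symmetric_operator \<omega> A \<and> (\<exists>!B. self_adjoint \<omega> B \<and> A \<subseteq>\<^sub>m B)"


definition laplacian ::
    "'v set set \<Rightarrow> ('v \<Rightarrow> real) \<Rightarrow> ('v set \<Rightarrow> real) \<Rightarrow> ('v \<Rightarrow> real) \<Rightarrow> ('v \<Rightarrow> real)" where
  "laplacian E \<omega> c f =
     (\<lambda>x. 1 / (\<omega> x)\<^sup>2 * (\<Sum>y\<in>neighbours E x. c {x, y} * (f x - f y)))"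

definition laplacian_C0 ::
    "'v set set \<Rightarrow> ('v \<Rightarrow> real) \<Rightarrow> ('v set \<Rightarrow> real) \<Rightarrow> 'v operator" where
  "laplacian_C0 E \<omega> c = (\<lambda>f. Some (laplacian E \<omega> c f)) |` C0"


text \<open>
  The weighted distance is a metric, so completeness of the vertex set can be stated with
  \<^const>\<open>Metric_space.mcomplete\<close>.
\<close>

lemma path_length_Cons2:
  "path_length a (x # y # p) = 1 / sqrt (a {x, y}) + path_length a (y # p)"
  unfolding path_length_def by (simp add: sum.lessThan_Suc_shift del: sum.lessThan_Suc)

lemma path_length_append:
  assumes "p \<noteq> []"
  shows "path_length a (p @ q) = path_length a p + path_length a (last p # q)"
  using assms
proof (induction p rule: induct_list012)
  case (3 x y zs)
  then show ?case by (simp add: path_length_Cons2)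
qed (auto simp: path_length_def)

lemma path_length_rev: "path_length a (rev p) = path_length a p"
proof (induction p rule: induct_list012)
  case (3 x y zs)
  have "path_length a (rev (x # y # zs)) = path_length a (rev (y # zs)) + path_length a [y, x]"
    using path_length_append[of "rev (y # zs)" a "[x]"] by simp
  also have "path_length a [y, x] = 1 / sqrt (a {x, y})"
    by (simp add: path_length_def insert_commute)
  finally show ?case using 3 by (simp add: path_length_Cons2)
qed (auto simp: path_length_def)

lemma path_length_nonneg:
  assumes "\<forall>e\<in>E. a e > 0" "successively (\<lambda>u v. {u, v} \<in> E) p"
  shows "path_length a p \<ge> 0"
  using assms(2)
proof (induction p rule: induct_list012)
  case (3 x y zs)
  then show ?case using assms(1) by (simp add: path_length_Cons2 add_nonneg_nonneg less_imp_le)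
qed (auto simp: path_length_def)

lemma edge_paths_rev:
  assumes "p \<in> edge_paths E x y"
  shows "rev p \<in> edge_paths E y x"
  using assms by (auto simp: edge_paths_def hd_rev last_rev insert_commute)

lemma edge_paths_append:
  assumes "p \<in> edge_paths E x y" "q \<in> edge_paths E y z"
  shows "p @ tl q \<in> edge_paths E x z"
    and "path_length a (p @ tl q) = path_length a p + path_length a q"
proof -
  obtain q' where q: "q = y # q'" using assms(2) by (cases q) (auto simp: edge_paths_def)
  show "p @ tl q \<in> edge_paths E x z"
    using assms by (cases q') (auto simp: q edge_paths_def successively_append_iff)
  show "path_length a (p @ tl q) = path_length a p + path_length a q"
    using assms(1) by (simp add: q path_length_append edge_paths_def)
qed

lemma Metric_space_weighted_dist:
  fixes E :: "'v set set"
  assumes lf: "locally_finite E" and con: "connected_graph E" and pos: "\<forall>e\<in>E. a e > 0"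
  shows "Metric_space UNIV (weighted_dist E a)"
proof -
  have ne: "edge_paths E x y \<noteq> {}" for x y
    using con by (auto simp: connected_graph_def)
  have nonneg: "path_length a p \<ge> 0" if "p \<in> edge_paths E x y" for p x y
    using that path_length_nonneg[OF pos] by (auto simp: edge_paths_def)
  have bdd: "bdd_below (path_length a ` edge_paths E x y)" for x y
    using nonneg by (intro bdd_belowI2[of _ 0]) auto
  have d0: "weighted_dist E a x y \<ge> 0" for x y
    unfolding weighted_dist_def by (intro cINF_greatest ne nonneg)
  have upper: "weighted_dist E a x y \<le> path_length a p" if "p \<in> edge_paths E x y" for x y p
    unfolding weighted_dist_def by (intro cINF_lower bdd that)
  have le_sym: "weighted_dist E a x y \<le> weighted_dist E a y x" for x y
    unfolding weighted_dist_def[of E a y x]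
    by (intro cINF_greatest ne) (metis edge_paths_rev path_length_rev upper)
  have refl: "weighted_dist E a x x = 0" for x
    using upper[of "[x]" x x] d0[of x x] by (auto simp: edge_paths_def path_length_def)
  have separated: "x = y" if "weighted_dist E a x y = 0" for x y
  proof (rule ccontr)
    assume "x \<noteq> y"
    define m where "m = Min (insert 1 ((\<lambda>z. 1 / sqrt (a {x, z})) ` neighbours E x))"
    have fin: "finite (insert 1 ((\<lambda>z. 1 / sqrt (a {x, z})) ` neighbours E x))"
      using lf by (auto simp: locally_finite_def)
    have "m > 0"
      unfolding m_def using fin pos by (subst Min_gr_iff) (auto simp: neighbours_def)
    have "m \<le> path_length a p" if p: "p \<in> edge_paths E x y" for p
    proof -
      obtain z p' where p_eq: "p = x # z # p'"
        using p \<open>x \<noteq> y\<close> by (cases p; cases "tl p") (auto simp: edge_paths_def)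
      have "m \<le> 1 / sqrt (a {x, z})"
        unfolding m_def using fin p by (intro Min_le) (auto simp: p_eq edge_paths_def neighbours_def)
      moreover have "path_length a (z # p') \<ge> 0"
        using p path_length_nonneg[OF pos, of "z # p'"] by (auto simp: p_eq edge_paths_def)
      ultimately show ?thesis by (simp add: p_eq path_length_Cons2)
    qed
    then have "m \<le> weighted_dist E a x y"
      unfolding weighted_dist_def by (intro cINF_greatest ne)
    with that \<open>m > 0\<close> show False by simp
  qed
  have triangle: "weighted_dist E a x z \<le> weighted_dist E a x y + weighted_dist E a y z" for x y z
  proof -
    have "weighted_dist E a x z - path_length a p \<le> weighted_dist E a y z"
      if "p \<in> edge_paths E x y" for p
      unfolding weighted_dist_def[of E a y z]
    proof (intro cINF_greatest ne)
      fix q assume "q \<in> edge_paths E y z"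
      then show "weighted_dist E a x z - path_length a p \<le> path_length a q"
        using edge_paths_append[OF that] upper by (metis diff_le_eq add.commute)
    qed
    then have "weighted_dist E a x z - weighted_dist E a y z \<le> weighted_dist E a x y"
      unfolding weighted_dist_def[of E a x y]
      by (intro cINF_greatest ne) (metis diff_le_eq add.commute)
    then show ?thesis by simp
  qed
  show ?thesis
    by unfold_locales (use d0 le_sym refl separated triangle in \<open>auto intro: antisym\<close>)
qed

end

theory Submission
  imports Defs
begin

text \<open>
  The adjoint of the Laplacian on \<open>C0\<close> is the maximal operator, with domain
  \<open>{g \<in> l2 \<omega>. \<Delta> g \<in> l2 \<omega>}\<close>, so it suffices that the latter is symmetric. Completeness makes
  \<open>\<delta>\<^sub>a\<close>-balls finite, hence there are finitely supported cutoffs \<open>\<eta> n\<close>, tending to \<open>1\<close>, that are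
  \<open>1 / (n + 1)\<close>-Lipschitz for \<open>\<delta>\<^sub>a\<close>, that is
  \<open>c {x, y} * (\<eta> n x - \<eta> n y)\<^sup>2 \<le> \<omega> x * \<omega> y / (n + 1)\<^sup>2\<close> on edges. A Caccioppoli estimate with
  these cutoffs shows that functions of the maximal domain have finite energy; with bounded
  degree, the commutator term in Green's formula for \<open>\<eta> n * f\<close> and \<open>g\<close> is then \<open>O(1 / n)\<close>.
\<close>

subsection \<open>Weighted square-summable functions\<close>

lemma l2_iff: "f \<in> l2 \<omega> \<longleftrightarrow> (\<lambda>x. (\<omega> x)\<^sup>2 * (f x)\<^sup>2) summable_on UNIV"
  by (simp add: l2_def)

lemma l2_inner_self: "l2_inner \<omega> f f = (\<Sum>\<^sub>\<infinity>x. (\<omega> x)\<^sup>2 * (f x)\<^sup>2)"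
  by (simp add: l2_inner_def power2_eq_square mult.assoc)

lemma l2_inner_self_nonneg: "l2_inner \<omega> f f \<ge> 0"
  unfolding l2_inner_self by (intro infsum_nonneg) auto

lemma sum_le_l2_inner_self:
  assumes "f \<in> l2 \<omega>" "finite S"
  shows "(\<Sum>x\<in>S. (\<omega> x)\<^sup>2 * (f x)\<^sup>2) \<le> l2_inner \<omega> f f"
  unfolding l2_inner_self
  by (rule finite_sum_le_infsum) (use assms in \<open>auto simp: l2_iff\<close>)

lemma l2_add:
  assumes "f \<in> l2 \<omega>" "g \<in> l2 \<omega>"
  shows "(\<lambda>x. f x + g x) \<in> l2 \<omega>"
proof -
  have "(\<lambda>x. 2 * ((\<omega> x)\<^sup>2 * (f x)\<^sup>2) + 2 * ((\<omega> x)\<^sup>2 * (g x)\<^sup>2)) summable_on UNIV"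
    using assms by (intro summable_on_add summable_on_cmult_right) (auto simp: l2_iff)
  then show ?thesis
    unfolding l2_iff
  proof (rule summable_on_comparison_test)
    fix x
    have "(f x + g x)\<^sup>2 \<le> 2 * (f x)\<^sup>2 + 2 * (g x)\<^sup>2"
      using sum_squares_bound[of "f x" "g x"] unfolding power2_sum by linarith
    then show "(\<omega> x)\<^sup>2 * (f x + g x)\<^sup>2 \<le> 2 * ((\<omega> x)\<^sup>2 * (f x)\<^sup>2) + 2 * ((\<omega> x)\<^sup>2 * (g x)\<^sup>2)"
      using mult_left_mono[of "(f x + g x)\<^sup>2" "2 * (f x)\<^sup>2 + 2 * (g x)\<^sup>2" "(\<omega> x)\<^sup>2"]
      by (simp add: distrib_left mult.left_commute)
  qed auto
qed

lemma l2_scale: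
  assumes "f \<in> l2 \<omega>"
  shows "(\<lambda>x. r * f x) \<in> l2 \<omega>"
  using summable_on_cmult_right[of "\<lambda>x. (\<omega> x)\<^sup>2 * (f x)\<^sup>2" UNIV "r\<^sup>2"] assms
  by (simp add: l2_iff power_mult_distrib mult.left_commute)

lemma C0_subset_l2: "C0 \<subseteq> l2 \<omega>"
proof
  fix f :: "'a \<Rightarrow> real" assume "f \<in> C0"
  then have "(\<lambda>x. (\<omega> x)\<^sup>2 * (f x)\<^sup>2) summable_on {x. f x \<noteq> 0}"
    by (intro summable_on_finite) (auto simp: C0_def)
  then show "f \<in> l2 \<omega>"
    unfolding l2_iff by (rule summable_on_cong_neutral[THEN iffD1, rotated -1]) auto
qed

lemma l2_mult_summable:
  assumes "f \<in> l2 \<omega>" "g \<in> l2 \<omega>"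
  shows "(\<lambda>x. (\<omega> x)\<^sup>2 * f x * g x) summable_on UNIV"
proof -
  have "(\<lambda>x. (\<omega> x)\<^sup>2 * (f x)\<^sup>2 + (\<omega> x)\<^sup>2 * (g x)\<^sup>2) summable_on UNIV"
    using assms by (intro summable_on_add) (auto simp: l2_iff)
  then have "(\<lambda>x. norm ((\<omega> x)\<^sup>2 * f x * g x)) summable_on UNIV"
  proof (rule Infinite_Sum.abs_summable_on_comparison_test')
    fix x
    have "\<bar>f x * g x\<bar> \<le> (f x)\<^sup>2 + (g x)\<^sup>2"
      using sum_squares_bound[of "f x" "g x"] sum_squares_bound[of "f x" "- g x"]
        sum_power2_ge_zero[of "f x" "g x"] by simp
    then show "norm ((\<omega> x)\<^sup>2 * f x * g x) \<le> (\<omega> x)\<^sup>2 * (f x)\<^sup>2 + (\<omega> x)\<^sup>2 * (g x)\<^sup>2"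
      using mult_left_mono[of "\<bar>f x * g x\<bar>" "(f x)\<^sup>2 + (g x)\<^sup>2" "(\<omega> x)\<^sup>2"]
      by (simp add: distrib_left abs_mult mult.assoc)
  qed
  then show ?thesis by (rule abs_summable_summable)
qed

lemma l2_inner_commute: "l2_inner \<omega> f g = l2_inner \<omega> g f"
  unfolding l2_inner_def by (rule infsum_cong) simp

lemma l2_inner_eq_sum:
  assumes "finite S" "\<And>x. x \<notin> S \<Longrightarrow> g x = 0"
  shows "l2_inner \<omega> f g = (\<Sum>x\<in>S. (\<omega> x)\<^sup>2 * f x * g x)"
proof -
  have "l2_inner \<omega> f g = (\<Sum>\<^sub>\<infinity>x\<in>S. (\<omega> x)\<^sup>2 * f x * g x)"
    unfolding l2_inner_def using assms by (intro infsum_cong_neutral) auto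
  with assms show ?thesis by simp
qed

text \<open>Truncating \<open>f\<close> to a finite set \<open>F\<close> that carries its squared
  norm up to \<open>\<epsilon>\<^sup>2 / 2\<close> suffices. The factor 1/2 turns the non-strict
  approximation bound into a strict one.\<close>

lemma C0_dense_l2:
  assumes f: "f \<in> l2 \<omega>" and "\<epsilon> > 0"
  obtains g where "g \<in> C0" "l2_norm \<omega> (\<lambda>x. f x - g x) < \<epsilon>"
proof -
  have sf: "(\<lambda>x. (\<omega> x)\<^sup>2 * (f x)\<^sup>2) summable_on UNIV"
    using f by (simp add: l2_iff)
  obtain F where F: "finite F"
    "dist (\<Sum>x\<in>F. (\<omega> x)\<^sup>2 * (f x)\<^sup>2) (\<Sum>\<^sub>\<infinity>x. (\<omega> x)\<^sup>2 * (f x)\<^sup>2) \<le> \<epsilon>\<^sup>2 / 2"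
    using infsum_finite_approximation[OF sf, of "\<epsilon>\<^sup>2 / 2"] \<open>\<epsilon> > 0\<close> by auto
  define g where "g = (\<lambda>x. if x \<in> F then f x else 0)"
  have "l2_inner \<omega> (\<lambda>x. f x - g x) (\<lambda>x. f x - g x) = (\<Sum>\<^sub>\<infinity>x\<in>UNIV - F. (\<omega> x)\<^sup>2 * (f x)\<^sup>2)"
    unfolding l2_inner_self by (rule infsum_cong_neutral) (auto simp: g_def)
  also have "\<dots> = (\<Sum>\<^sub>\<infinity>x. (\<omega> x)\<^sup>2 * (f x)\<^sup>2) - (\<Sum>x\<in>F. (\<omega> x)\<^sup>2 * (f x)\<^sup>2)"
    using F(1) by (subst infsum_Diff) (auto intro: sf)
  also have "\<dots> \<le> \<epsilon>\<^sup>2 / 2" using F(2) unfolding dist_real_def by linarith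
  also have "\<dots> < \<epsilon>\<^sup>2" using \<open>\<epsilon> > 0\<close> by simp
  finally have "l2_norm \<omega> (\<lambda>x. f x - g x) < \<epsilon>"
    unfolding l2_norm_def using \<open>\<epsilon> > 0\<close> by (simp add: real_less_lsqrt)
  moreover have "g \<in> C0" using F(1) by (auto simp: C0_def g_def intro: finite_subset[of _ F])
  ultimately show thesis using that by blast
qed

text \<open>Dominated convergence for sums, with majorant \<bar>h\<bar>: the tail outside a finite
  set is small for all \<open>n\<close> at once, and on the finite set pointwise convergence is
  enough.\<close>

lemma infsum_mult_tendsto:
  fixes h :: "'a \<Rightarrow> real" and \<eta> :: "nat \<Rightarrow> 'a \<Rightarrow> real"
  assumes h: "h summable_on UNIV"
    and \<eta>: "\<And>n x. 0 \<le> \<eta> n x" "\<And>n x. \<eta> n x \<le> 1" "\<And>x. (\<lambda>n. \<eta> n x) \<longlonglongrightarrow> 1"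
  shows "(\<lambda>n. \<Sum>\<^sub>\<infinity>x. \<eta> n x * h x) \<longlonglongrightarrow> (\<Sum>\<^sub>\<infinity>x. h x)"
proof (rule LIMSEQ_I)
  fix e :: real assume "e > 0"
  let ?P = "\<Sum>\<^sub>\<infinity>x. \<bar>h x\<bar>"
  have ah: "(\<lambda>x. \<bar>h x\<bar>) summable_on UNIV"
    using h summable_on_iff_abs_summable_on_real[of h UNIV] by simp
  obtain F where F: "finite F" "dist (\<Sum>x\<in>F. \<bar>h x\<bar>) ?P \<le> e / 2"
    using infsum_finite_approximation[OF ah, of "e / 2"] \<open>e > 0\<close> by auto
  have \<eta>h: "(\<lambda>x. norm (\<eta> n x * h x)) summable_on UNIV" for n
    by (rule Infinite_Sum.abs_summable_on_comparison_test'[OF ah])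
      (use \<eta> in \<open>auto simp: abs_mult intro!: mult_left_le_one_le\<close>)
  \<comment> \<open>On \<open>F\<close> the error is (1 - \<eta>) \<bar>h\<bar>, elsewhere at most
    \<bar>h\<bar>. As \<open>n\<close> grows, the right-hand side tends to the mass of \<bar>h\<bar>
    outside \<open>F\<close>, which is at most \<open>e / 2\<close>.\<close>
  have *: "norm ((\<Sum>\<^sub>\<infinity>x. \<eta> n x * h x) - (\<Sum>\<^sub>\<infinity>x. h x)) \<le> ?P - (\<Sum>x\<in>F. \<eta> n x * \<bar>h x\<bar>)" for n
  proof -
    have sF: "(\<lambda>x. if x \<in> F then - (\<eta> n x * \<bar>h x\<bar>) else 0) summable_on UNIV"
      using summable_on_cong_neutral[of UNIV F "\<lambda>x. if x \<in> F then - (\<eta> n x * \<bar>h x\<bar>) else 0"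
          "\<lambda>x. - (\<eta> n x * \<bar>h x\<bar>)"] F(1) by auto
    have "(\<lambda>x. \<eta> n x * h x - h x) summable_on UNIV"
      using summable_on_add[OF abs_summable_summable[OF \<eta>h] summable_on_uminus[THEN iffD2, OF h]]
      unfolding diff_conv_add_uminus .
    then have s: "(\<lambda>x. norm (\<eta> n x * h x - h x)) summable_on UNIV"
      by (rule summable_on_iff_abs_summable_on_real[THEN iffD1])
    have "(\<Sum>\<^sub>\<infinity>x. \<eta> n x * h x) - (\<Sum>\<^sub>\<infinity>x. h x) = (\<Sum>\<^sub>\<infinity>x. \<eta> n x * h x - h x)"
      using infsum_add[OF abs_summable_summable[OF \<eta>h] summable_on_uminus[THEN iffD2, OF h]]
      by (simp add: infsum_uminus)
    also have "norm \<dots> \<le> (\<Sum>\<^sub>\<infinity>x. norm (\<eta> n x * h x - h x))"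
      by (rule norm_infsum_bound[OF s])
    also have "\<dots> \<le> (\<Sum>\<^sub>\<infinity>x. \<bar>h x\<bar> + (if x \<in> F then - (\<eta> n x * \<bar>h x\<bar>) else 0))"
    proof (rule infsum_mono[OF s summable_on_add[OF ah sF]])
      fix x
      have "norm (\<eta> n x * h x - h x) = (1 - \<eta> n x) * \<bar>h x\<bar>"
        using \<eta>(2)[of n x] abs_mult[of "\<eta> n x - 1" "h x"] by (simp add: left_diff_distrib)
      then show "norm (\<eta> n x * h x - h x) \<le> \<bar>h x\<bar> + (if x \<in> F then - (\<eta> n x * \<bar>h x\<bar>) else 0)"
        using \<eta>(1)[of n x] by (simp add: left_diff_distrib)
    qed
    also have "\<dots> = ?P + (\<Sum>\<^sub>\<infinity>x. if x \<in> F then - (\<eta> n x * \<bar>h x\<bar>) else 0)"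
      by (rule infsum_add[OF ah sF])
    also have "(\<Sum>\<^sub>\<infinity>x. if x \<in> F then - (\<eta> n x * \<bar>h x\<bar>) else 0) = (\<Sum>\<^sub>\<infinity>x\<in>F. - (\<eta> n x * \<bar>h x\<bar>))"
      by (rule infsum_cong_neutral) auto
    also have "\<dots> = - (\<Sum>x\<in>F. \<eta> n x * \<bar>h x\<bar>)" using F(1) by (simp add: sum_negf)
    finally show ?thesis by simp
  qed
  have "(\<lambda>n. ?P - (\<Sum>x\<in>F. \<eta> n x * \<bar>h x\<bar>)) \<longlonglongrightarrow> ?P - (\<Sum>x\<in>F. 1 * \<bar>h x\<bar>)"
    by (intro tendsto_intros \<eta>)
  moreover have "?P - (\<Sum>x\<in>F. 1 * \<bar>h x\<bar>) < e"
    using F(2) \<open>e > 0\<close> unfolding dist_real_def mult_1 by linarith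
  ultimately have "\<forall>\<^sub>F n in sequentially. ?P - (\<Sum>x\<in>F. \<eta> n x * \<bar>h x\<bar>) < e"
    by (rule order_tendstoD)
  then show "\<exists>no. \<forall>n\<ge>no. norm ((\<Sum>\<^sub>\<infinity>x. \<eta> n x * h x) - (\<Sum>\<^sub>\<infinity>x. h x)) < e"
    using * unfolding eventually_sequentially by (meson le_less_trans)
qed

subsection \<open>Finiteness of balls and cutoff functions\<close>

text \<open>
  Koenig's argument: an infinite ball yields an infinite path of finite length, whose vertices form a
  Cauchy sequence; its limit is isolated, although consecutive vertices of the path are distinct.
\<close>

lemma finite_path_ball:
  fixes E :: "'v set set"
  assumes sg: "simple_graph E" and lf: "locally_finite E" and con: "connected_graph E"
    and pos: "\<forall>e\<in>E. a e > 0"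
    and complete: "Metric_space.mcomplete UNIV (weighted_dist E a)"
  shows "finite {y. weighted_dist E a x y < r}"
proof (rule ccontr)
  interpret Metric_space UNIV "weighted_dist E a"
    by (rule Metric_space_weighted_dist[OF lf con pos])
  have upper: "weighted_dist E a x y \<le> path_length a p" if "p \<in> edge_paths E x y" for x y p
    unfolding weighted_dist_def
    by (intro cINF_lower that bdd_belowI2[of _ 0] path_length_nonneg[OF pos])
      (auto simp: edge_paths_def)
  \<comment> \<open>A pair \<open>(x, r)\<close> is a vertex with a remaining length budget.
    Reachability by paths, unlike the infimum, lets the first edge be split off exactly.\<close>
  define I where "I = (\<lambda>(x, r). {y. \<exists>p\<in>edge_paths E x y. path_length a p < r})"
  assume "infinite {y. weighted_dist E a x y < r}"
  moreover have "{y. weighted_dist E a x y < r} \<subseteq> I (x, r)"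
  proof clarify
    fix y assume "weighted_dist E a x y < r"
    then show "y \<in> I (x, r)"
      using cInf_lessD[of "path_length a ` edge_paths E x y" r] con
      by (auto simp: weighted_dist_def I_def connected_graph_def)
  qed
  ultimately have inf0: "infinite (I (x, r))" by (meson finite_subset)
  \<comment> \<open>Pigeonhole: dropping the first edge of each path covers \<open>I s\<close> by
    one vertex and finitely many sets \<open>I t\<close>, one for each neighbour, so one of these is
    infinite.\<close>
  have step: "\<exists>t. infinite (I t) \<and> {fst s, fst t} \<in> E \<and> snd s = 1 / sqrt (a {fst s, fst t}) + snd t"
    if "infinite (I s)" for s
  proof (rule ccontr)
    obtain u q where s: "s = (u, q)" by (cases s)
    assume neg: "\<nexists>t. infinite (I t) \<and> {fst s, fst t} \<in> E \<and> snd s = 1 / sqrt (a {fst s, fst t}) + snd t"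
    have "finite (I (z, q - 1 / sqrt (a {u, z})))" if "z \<in> neighbours E u" for z
      using neg[unfolded s, simplified, rule_format, of z] that
      by (force simp: neighbours_def)
    then have fin: "finite (insert u (\<Union>z\<in>neighbours E u. I (z, q - 1 / sqrt (a {u, z}))))"
      using lf by (auto simp: locally_finite_def)
    have "I s \<subseteq> insert u (\<Union>z\<in>neighbours E u. I (z, q - 1 / sqrt (a {u, z})))"
    proof
      fix y assume "y \<in> I s"
      then obtain p where p: "p \<in> edge_paths E u y" "path_length a p < q"
        by (auto simp: I_def s)
      show "y \<in> insert u (\<Union>z\<in>neighbours E u. I (z, q - 1 / sqrt (a {u, z})))"
      proof (cases "tl p")
        case Nil
        with p show ?thesis by (cases p) (auto simp: edge_paths_def)
      next
        case (Cons z p')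
        with p have "p = u # z # p'" by (cases p) (auto simp: edge_paths_def)
        with p have "z \<in> neighbours E u" "z # p' \<in> edge_paths E z y"
          "path_length a (z # p') < q - 1 / sqrt (a {u, z})"
          by (auto simp: edge_paths_def neighbours_def path_length_Cons2)
        then show ?thesis by (auto simp: I_def)
      qed
    qed
    with fin that show False by (meson finite_subset)
  qed
  obtain \<sigma> where \<sigma>: "\<And>n. infinite (I (\<sigma> n))"
    "\<And>n. {fst (\<sigma> n), fst (\<sigma> (Suc n))} \<in> E"
    "\<And>n. snd (\<sigma> n) = 1 / sqrt (a {fst (\<sigma> n), fst (\<sigma> (Suc n))}) + snd (\<sigma> (Suc n))"
  proof -
    have "\<exists>\<sigma>. \<forall>n. infinite (I (\<sigma> n)) \<and> {fst (\<sigma> n), fst (\<sigma> (Suc n))} \<in> E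
        \<and> snd (\<sigma> n) = 1 / sqrt (a {fst (\<sigma> n), fst (\<sigma> (Suc n))}) + snd (\<sigma> (Suc n))"
      by (rule dependent_nat_choice) (use inf0 step in blast)+
    then show thesis using that by blast
  qed
  define v where "v n = fst (\<sigma> n)" for n
  define \<rho> where "\<rho> n = snd (\<sigma> n)" for n
  have edge: "{v n, v (Suc n)} \<in> E" for n using \<sigma>(2) by (simp add: v_def)
  have dstep: "weighted_dist E a (v n) (v (Suc n)) \<le> \<rho> n - \<rho> (Suc n)" for n
    using upper[of "[v n, v (Suc n)]" "v n" "v (Suc n)"] edge[of n] \<sigma>(3)[of n]
    by (simp add: edge_paths_def path_length_def v_def \<rho>_def)
  have dist_le: "weighted_dist E a (v m) (v n) \<le> \<rho> m - \<rho> n" if "m \<le> n" for m n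
    using that
  proof (induction n rule: dec_induct)
    case (step n)
    then show ?case
      using triangle[of "v m" "v n" "v (Suc n)"] dstep[of n] by simp
  qed simp
  \<comment> \<open>An infinite \<open>I (\<sigma> n)\<close> contains a point, and the path to it
    has nonnegative length below \<open>\<rho> n\<close>. The budgets thus decrease and are bounded
    below, so they converge.\<close>
  have "\<rho> n > 0" for n
  proof -
    obtain y where "y \<in> I (\<sigma> n)" using \<sigma>(1)[of n] by fastforce
    then obtain p where "p \<in> edge_paths E (v n) y" "path_length a p < \<rho> n"
      by (auto simp: I_def v_def \<rho>_def split: prod.splits)
    then show ?thesis using path_length_nonneg[OF pos, of p] by (auto simp: edge_paths_def)
  qed
  moreover have "decseq \<rho>"
    using order.trans[OF nonneg dstep] by (intro decseq_SucI) simp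
  ultimately obtain L where "\<rho> \<longlonglongrightarrow> L"
    using decseq_convergent[of \<rho> 0] by (metis less_imp_le)
  then have \<rho>: "Cauchy \<rho>" by (rule LIMSEQ_imp_Cauchy)
  have "MCauchy v"
    unfolding MCauchy_def
  proof (intro conjI allI impI)
    fix e :: real assume "e > 0"
    then obtain M where M: "\<And>m n. m \<ge> M \<Longrightarrow> n \<ge> M \<Longrightarrow> dist (\<rho> m) (\<rho> n) < e"
      using \<rho> by (metis metric_CauchyD)
    have "weighted_dist E a (v m) (v n) < e" if "M \<le> m" "M \<le> n" for m n
      using M[OF that] dist_le[of m n] dist_le[of n m] commute[of "v m" "v n"]
      by (cases "m \<le> n") (auto simp: dist_real_def)
    then show "\<exists>M. \<forall>n n'. M \<le> n \<longrightarrow> M \<le> n' \<longrightarrow> weighted_dist E a (v n) (v n') < e" by blast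
  qed auto
  then obtain w where w: "limitin mtopology v w sequentially"
    using complete by (auto simp: mcomplete_def)
  \<comment> \<open>A path from \<open>w\<close> to another vertex starts with an edge at
    \<open>w\<close>, so \<open>m\<close> bounds its length from below. The inserted 1 keeps the
    minimum meaningful without neighbours.\<close>
  define m where "m = Min (insert 1 ((\<lambda>z. 1 / sqrt (a {w, z})) ` neighbours E w))"
  have fin: "finite (insert 1 ((\<lambda>z. 1 / sqrt (a {w, z})) ` neighbours E w))"
    using lf by (auto simp: locally_finite_def)
  have "m > 0"
    unfolding m_def using fin pos by (subst Min_gr_iff) (auto simp: neighbours_def)
  have isolated: "y = w" if near: "weighted_dist E a w y < m" for y
  proof (rule ccontr)
    assume "y \<noteq> w"
    obtain p where p: "p \<in> edge_paths E w y" "path_length a p < m"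
      using near cInf_lessD[of "path_length a ` edge_paths E w y" m] con
      by (auto simp: weighted_dist_def connected_graph_def)
    obtain z p' where p_eq: "p = w # z # p'"
      using p \<open>y \<noteq> w\<close> by (cases p; cases "tl p") (auto simp: edge_paths_def)
    have "m \<le> 1 / sqrt (a {w, z})"
      unfolding m_def using fin p by (intro Min_le) (auto simp: p_eq edge_paths_def neighbours_def)
    moreover have "path_length a (z # p') \<ge> 0"
      using p path_length_nonneg[OF pos, of "z # p'"] by (auto simp: p_eq edge_paths_def)
    ultimately show False using p by (simp add: p_eq path_length_Cons2)
  qed
  obtain M where "\<And>n. n \<ge> M \<Longrightarrow> weighted_dist E a (v n) w < m"
    using w \<open>m > 0\<close> by (auto simp: limit_metric_sequentially)
  then have "v M = w" "v (Suc M) = w"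
    using isolated commute by (metis le_refl, metis le_SucI le_refl)
  with edge[of M] sg show False by (auto simp: simple_graph_def doubleton_eq_iff)
qed

text \<open>The radius \<open>Suc n\<close> avoids division by zero. With growing \<open>n\<close>
  the slope tends to 0 and the value at each fixed vertex tends to 1.\<close>

definition cutoff :: "'v set set \<Rightarrow> ('v set \<Rightarrow> real) \<Rightarrow> 'v \<Rightarrow> nat \<Rightarrow> 'v \<Rightarrow> real" where
  "cutoff E a x0 n x = max 0 (1 - weighted_dist E a x0 x / real (Suc n))"

section \<open>Range, limit, support and Lipschitz bound of the cutoffs\<close>

context
  fixes E :: "'v set set" and a :: "'v set \<Rightarrow> real" and x0 :: 'v
  assumes sg: "simple_graph E" and lf: "locally_finite E" and con: "connected_graph E"
    and pos: "\<forall>e\<in>E. a e > 0"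
begin

interpretation Metric_space UNIV "weighted_dist E a"
  by (rule Metric_space_weighted_dist[OF lf con pos])

lemma cutoff_nonneg: "0 \<le> cutoff E a x0 n x"
  by (simp add: cutoff_def)

lemma cutoff_le_1: "cutoff E a x0 n x \<le> 1"
  by (simp add: cutoff_def)

lemma cutoff_tendsto: "(\<lambda>n. cutoff E a x0 n x) \<longlonglongrightarrow> 1"
proof -
  have "(\<lambda>n. max 0 (1 - weighted_dist E a x0 x / real (Suc n))) \<longlonglongrightarrow> max 0 (1 - 0)"
    by (intro tendsto_intros LIMSEQ_Suc[OF lim_const_over_n])
  then show ?thesis by (simp add: cutoff_def)
qed

lemma cutoff_finite_support:
  assumes "Metric_space.mcomplete UNIV (weighted_dist E a)"
  shows "finite {x. cutoff E a x0 n x \<noteq> 0}"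
proof (rule finite_subset[OF _ finite_path_ball[OF sg lf con pos assms, of x0 "real (Suc n)"]])
  show "{x. cutoff E a x0 n x \<noteq> 0} \<subseteq> {y. weighted_dist E a x0 y < real (Suc n)}"
    by (auto simp: cutoff_def max_def field_simps split: if_splits)
qed

text \<open>The edge is itself a path, so the distance to \<open>x0\<close> changes across it by at
  most 1 / sqrt a. Truncation at 0 does not increase differences.\<close>

lemma cutoff_edge:
  assumes "{x, y} \<in> E"
  shows "a {x, y} * (cutoff E a x0 n x - cutoff E a x0 n y)\<^sup>2 \<le> (1 / real (Suc n))\<^sup>2"
proof -
  have apos: "a {x, y} > 0" using assms pos by blast
  have "weighted_dist E a x y \<le> path_length a [x, y]"
    unfolding weighted_dist_def using assms
    by (intro cINF_lower bdd_belowI2[of _ 0] path_length_nonneg[OF pos])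
      (auto simp: edge_paths_def)
  then have "weighted_dist E a x y \<le> 1 / sqrt (a {x, y})"
    by (simp add: path_length_def)
  then have d: "\<bar>weighted_dist E a x0 x - weighted_dist E a x0 y\<bar> \<le> 1 / sqrt (a {x, y})"
    using triangle[of x0 x y] triangle[of x0 y x] commute[of x y] by auto
  have "\<bar>cutoff E a x0 n x - cutoff E a x0 n y\<bar>
      \<le> \<bar>weighted_dist E a x0 x / real (Suc n) - weighted_dist E a x0 y / real (Suc n)\<bar>"
    unfolding cutoff_def by linarith
  also have "\<dots> = \<bar>weighted_dist E a x0 x - weighted_dist E a x0 y\<bar> / real (Suc n)"
    by (simp flip: diff_divide_distrib)
  also have "\<dots> \<le> 1 / sqrt (a {x, y}) / real (Suc n)"
    by (intro divide_right_mono d) auto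
  finally have "(cutoff E a x0 n x - cutoff E a x0 n y)\<^sup>2 \<le> (1 / sqrt (a {x, y}) / real (Suc n))\<^sup>2"
    by (rule power2_le_iff_abs_le[THEN iffD2, rotated]) (use apos in simp)
  also have "\<dots> = (1 / real (Suc n))\<^sup>2 / a {x, y}"
    using apos by (simp add: power_divide power_mult_distrib)
  finally show ?thesis using apos by (simp add: pos_le_divide_eq mult.commute)
qed

end

subsection \<open>Green's formula and the energy bound\<close>

text \<open>The hypotheses give sqrt k * \<bar>t\<bar> \<le> \<epsilon> * q, and the
  arithmetic-geometric mean inequality splits the remaining product of sqrt k * \<bar>d\<bar> and q
  * \<bar>v\<bar>. In the application \<open>q\<close> is the larger endpoint weight and
  \<open>v\<close> the value of a function there.\<close>

lemma weighted_mult_le: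
  fixes p q k t d v \<epsilon> :: real
  assumes "0 \<le> p" "p \<le> q" "0 \<le> k" "0 \<le> \<epsilon>" "k * t\<^sup>2 \<le> \<epsilon>\<^sup>2 * (p * q)"
  shows "\<bar>k * t * (d * v)\<bar> \<le> \<epsilon> / 2 * (k * d\<^sup>2 + q\<^sup>2 * v\<^sup>2)"
proof -
  have "k * t\<^sup>2 \<le> (\<epsilon> * q)\<^sup>2"
    using assms mult_right_mono[of p q q] mult_left_mono[of "p * q" "q\<^sup>2" "\<epsilon>\<^sup>2"]
    by (simp add: power2_eq_square mult_ac)
  then have "sqrt k * \<bar>t\<bar> \<le> \<epsilon> * q"
    using assms real_sqrt_le_mono[of "k * t\<^sup>2" "(\<epsilon> * q)\<^sup>2"] by (simp add: real_sqrt_mult)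
  then have "(sqrt k * \<bar>t\<bar>) * (sqrt k * \<bar>d\<bar> * \<bar>v\<bar>) \<le> (\<epsilon> * q) * (sqrt k * \<bar>d\<bar> * \<bar>v\<bar>)"
    using assms by (intro mult_right_mono) auto
  moreover have "\<bar>k * t * (d * v)\<bar> = (sqrt k * sqrt k) * \<bar>t\<bar> * (\<bar>d\<bar> * \<bar>v\<bar>)"
    using assms by (simp add: abs_mult)
  moreover have "\<epsilon> * (2 * (sqrt k * \<bar>d\<bar>) * (q * \<bar>v\<bar>)) \<le> \<epsilon> * ((sqrt k * \<bar>d\<bar>)\<^sup>2 + (q * \<bar>v\<bar>)\<^sup>2)"
    using assms by (intro mult_left_mono sum_squares_bound) auto
  moreover have "(sqrt k * \<bar>d\<bar>)\<^sup>2 + (q * \<bar>v\<bar>)\<^sup>2 = k * d\<^sup>2 + q\<^sup>2 * v\<^sup>2"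
    using assms by (simp add: power_mult_distrib)
  ultimately show ?thesis by (simp add: mult_ac)
qed

locale weighted_graph =
  fixes E :: "'v set set" and \<omega> :: "'v \<Rightarrow> real" and c :: "'v set \<Rightarrow> real" and N :: nat
  assumes fin_nbr: "finite (neighbours E x)"
    and card_nbr: "card (neighbours E x) \<le> N"
    and \<omega>_pos: "\<omega> x > 0"
    and c_pos: "e \<in> E \<Longrightarrow> c e > 0"
begin

abbreviation "\<Delta> \<equiv> laplacian E \<omega> c"

text \<open>Ordered pairs count every edge twice. This makes sums invariant under swapping endpoints
  and causes the division by 2 in \<open>green\<close>.\<close>

definition edges_in :: "'v set \<Rightarrow> ('v \<times> 'v) set" where
  "edges_in S = {(x, y). x \<in> S \<and> y \<in> S \<and> {x, y} \<in> E}"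

lemma finite_edges_in: "finite S \<Longrightarrow> finite (edges_in S)"
  by (rule finite_subset[of _ "S \<times> S"]) (auto simp: edges_in_def)

lemma edges_in_Sigma: "edges_in S = (SIGMA x:S. neighbours E x \<inter> S)"
  by (auto simp: edges_in_def neighbours_def)

lemma sum_edges_swap: "(\<Sum>(x, y)\<in>edges_in S. F x y) = (\<Sum>(x, y)\<in>edges_in S. F y x)"
  by (rule sum.reindex_bij_witness[of _ prod.swap prod.swap])
    (auto simp: edges_in_def insert_commute)

text \<open>Bounded degree enters here: a vertex is the first component of at most \<open>N\<close>
  pairs.\<close>

lemma sum_edges_degree_le:
  fixes F :: "'v \<Rightarrow> real"
  assumes "finite S" "\<And>x. F x \<ge> 0"
  shows "(\<Sum>(x, y)\<in>edges_in S. F x) \<le> real N * (\<Sum>x\<in>S. F x)"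
proof -
  have "(\<Sum>(x, y)\<in>edges_in S. F x) = (\<Sum>x\<in>S. real (card (neighbours E x \<inter> S)) * F x)"
    unfolding edges_in_Sigma using assms(1) by (subst sum.Sigma[symmetric]) auto
  also have "\<dots> \<le> (\<Sum>x\<in>S. real N * F x)"
    using assms(2) order.trans[OF card_mono[OF fin_nbr Int_lower1] card_nbr]
    by (intro sum_mono mult_right_mono) auto
  finally show ?thesis by (simp add: sum_distrib_left)
qed

lemma sum_edges_vertex_le:
  assumes f: "f \<in> l2 \<omega>" and "finite S"
  shows "(\<Sum>(x, y)\<in>edges_in S. (\<omega> x)\<^sup>2 * (f x)\<^sup>2) \<le> real N * l2_inner \<omega> f f"
  using assms
  by (intro order.trans[OF sum_edges_degree_le] mult_left_mono sum_le_l2_inner_self) auto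

text \<open>Summation by parts without boundary terms: where \<phi> is nonzero, no edge leaves
  \<open>S\<close>. Averaging the double sum with its image under the swap of endpoints produces the
  difference of \<phi>.\<close>

lemma green:
  assumes S: "finite S" "\<And>x. \<phi> x \<noteq> 0 \<Longrightarrow> x \<in> S" "\<And>x. \<phi> x \<noteq> 0 \<Longrightarrow> neighbours E x \<subseteq> S"
  shows "(\<Sum>x\<in>S. (\<omega> x)\<^sup>2 * \<Delta> f x * \<phi> x)
    = (\<Sum>(x, y)\<in>edges_in S. c {x, y} * (f x - f y) * (\<phi> x - \<phi> y)) / 2"
proof -
  have "(\<Sum>x\<in>S. (\<omega> x)\<^sup>2 * \<Delta> f x * \<phi> x)
      = (\<Sum>x\<in>S. \<Sum>y\<in>neighbours E x \<inter> S. c {x, y} * (f x - f y) * \<phi> x)"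
  proof (rule sum.cong[OF refl])
    fix x assume "x \<in> S"
    have "(\<omega> x)\<^sup>2 * \<Delta> f x * \<phi> x = (\<Sum>y\<in>neighbours E x. c {x, y} * (f x - f y)) * \<phi> x"
      using \<omega>_pos[of x] by (simp add: laplacian_def)
    also have "\<dots> = (\<Sum>y\<in>neighbours E x \<inter> S. c {x, y} * (f x - f y) * \<phi> x)"
      using S(3)[of x] by (cases "\<phi> x = 0") (auto simp: sum_distrib_right Int_absorb2)
    finally show "(\<omega> x)\<^sup>2 * \<Delta> f x * \<phi> x
      = (\<Sum>y\<in>neighbours E x \<inter> S. c {x, y} * (f x - f y) * \<phi> x)" .
  qed
  also have "\<dots> = (\<Sum>(x, y)\<in>edges_in S. c {x, y} * (f x - f y) * \<phi> x)"
    unfolding edges_in_Sigma using S(1) by (subst sum.Sigma) auto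
  finally have 1: "(\<Sum>x\<in>S. (\<omega> x)\<^sup>2 * \<Delta> f x * \<phi> x)
      = (\<Sum>(x, y)\<in>edges_in S. c {x, y} * (f x - f y) * \<phi> x)" .
  also have "\<dots> = (\<Sum>(x, y)\<in>edges_in S. c {x, y} * (f y - f x) * \<phi> y)"
    by (subst sum_edges_swap) (simp add: insert_commute)
  finally have "2 * (\<Sum>x\<in>S. (\<omega> x)\<^sup>2 * \<Delta> f x * \<phi> x)
      = (\<Sum>(x, y)\<in>edges_in S. c {x, y} * (f x - f y) * \<phi> x)
        + (\<Sum>(x, y)\<in>edges_in S. c {x, y} * (f y - f x) * \<phi> y)"
    using 1 by simp
  also have "\<dots> = (\<Sum>(x, y)\<in>edges_in S. c {x, y} * (f x - f y) * (\<phi> x - \<phi> y))"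
    by (subst sum.distrib[symmetric]) (auto simp: algebra_simps intro!: sum.cong)
  finally show ?thesis by simp
qed

lemma finite_neighbourhood:
  assumes "finite {x. \<eta> x \<noteq> 0}"
  obtains S where "finite S" "\<And>x. \<eta> x \<noteq> 0 \<Longrightarrow> x \<in> S" "\<And>x. \<eta> x \<noteq> 0 \<Longrightarrow> neighbours E x \<subseteq> S"
  using that[of "{x. \<eta> x \<noteq> 0} \<union> (\<Union>x\<in>{x. \<eta> x \<noteq> 0}. neighbours E x)"] assms fin_nbr by auto

text \<open>Adjacency is symmetric, so a neighbour of \<open>x\<close> in the support of
  \<open>f\<close> would force \<open>x\<close> into \<open>S\<close>.\<close>

lemma laplacian_eq_0:
  assumes "\<And>x. f x \<noteq> 0 \<Longrightarrow> x \<in> S" "\<And>x. f x \<noteq> 0 \<Longrightarrow> neighbours E x \<subseteq> S" "x \<notin> S"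
  shows "\<Delta> f x = 0"
proof -
  have "f x = 0" "\<And>y. y \<in> neighbours E x \<Longrightarrow> f y = 0"
    using assms by (auto simp: neighbours_def insert_commute)
  then show ?thesis by (simp add: laplacian_def)
qed

text \<open>Both pairings are finite sums because \<open>f\<close> has finite support, so
  \<open>g\<close> may be arbitrary. This freedom is what later identifies adjoint values, where
  nothing is known about \<Delta> g in advance.\<close>

lemma laplacian_C0_symmetric:
  assumes "f \<in> C0"
  shows "l2_inner \<omega> (\<Delta> f) g = l2_inner \<omega> f (\<Delta> g)"
proof -
  obtain S where S: "finite S" "\<And>x. f x \<noteq> 0 \<Longrightarrow> x \<in> S" "\<And>x. f x \<noteq> 0 \<Longrightarrow> neighbours E x \<subseteq> S"
    using assms finite_neighbourhood[of f] by (auto simp: C0_def)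
  text \<open>Green's formula is applied with a truncation of \<open>g\<close>, which agrees with \<open>g\<close> where \<open>\<Delta> f\<close> lives.\<close>
  have zero: "\<Delta> f x = 0" if "x \<notin> S" for x
    using S(2,3) that by (rule laplacian_eq_0)
  \<comment> \<open>The truncation \<open>g'\<close> lives on \<open>S\<close>, so
    \<open>green\<close> with \<open>g'\<close> as test function requires one further layer of
    neighbours.\<close>
  obtain T where T: "finite T" "S \<subseteq> T" "\<And>x. x \<in> S \<Longrightarrow> neighbours E x \<subseteq> T"
    using that[of "S \<union> (\<Union>x\<in>S. neighbours E x)"] S(1) fin_nbr by auto
  define g' where "g' = (\<lambda>x. if x \<in> S then g x else 0)"
  have "l2_inner \<omega> (\<Delta> f) g = l2_inner \<omega> g (\<Delta> f)" by (rule l2_inner_commute)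
  also have "\<dots> = (\<Sum>x\<in>T. (\<omega> x)\<^sup>2 * g x * \<Delta> f x)"
    using T zero by (intro l2_inner_eq_sum) auto
  also have "\<dots> = (\<Sum>x\<in>T. (\<omega> x)\<^sup>2 * \<Delta> f x * g' x)"
    by (rule sum.cong) (auto simp: g'_def zero)
  also have "\<dots> = (\<Sum>(x, y)\<in>edges_in T. c {x, y} * (f x - f y) * (g' x - g' y)) / 2"
    using T by (intro green) (auto simp: g'_def split: if_splits)
  also have "\<dots> = (\<Sum>(x, y)\<in>edges_in T. c {x, y} * (g' x - g' y) * (f x - f y)) / 2"
    by (simp add: mult_ac)
  also have "\<dots> = (\<Sum>x\<in>T. (\<omega> x)\<^sup>2 * \<Delta> g' x * f x)"
    using S T by (intro green[symmetric]) auto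
  also have "\<dots> = (\<Sum>x\<in>T. (\<omega> x)\<^sup>2 * \<Delta> g x * f x)"
  proof (rule sum.cong[OF refl])
    fix x
    have "\<Delta> g' x = \<Delta> g x" if "f x \<noteq> 0"
    proof -
      have "g' x = g x" "\<And>y. y \<in> neighbours E x \<Longrightarrow> g' y = g y"
        using S(2,3)[OF that] by (auto simp: g'_def)
      then show ?thesis by (simp add: laplacian_def)
    qed
    then show "(\<omega> x)\<^sup>2 * \<Delta> g' x * f x = (\<omega> x)\<^sup>2 * \<Delta> g x * f x" by auto
  qed
  also have "\<dots> = l2_inner \<omega> (\<Delta> g) f"
    using S T by (intro l2_inner_eq_sum[symmetric]) auto
  finally show ?thesis by (simp add: l2_inner_commute)
qed

lemma laplacian_in_C0:
  assumes "f \<in> C0"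
  shows "\<Delta> f \<in> C0"
proof -
  obtain S where S: "finite S" "\<And>x. f x \<noteq> 0 \<Longrightarrow> x \<in> S" "\<And>x. f x \<noteq> 0 \<Longrightarrow> neighbours E x \<subseteq> S"
    using assms finite_neighbourhood[of f] by (auto simp: C0_def)
  have "{x. \<Delta> f x \<noteq> 0} \<subseteq> S"
    using laplacian_eq_0[OF S(2,3)] by blast
  with S(1) show ?thesis by (auto simp: C0_def intro: finite_subset)
qed

text \<open>
  The identity
  \<open>(f x - f y) * (s\<^sup>2 * f x - t\<^sup>2 * f y) = (s * f x - t * f y)\<^sup>2 - f x * f y * (s - t)\<^sup>2\<close>
  leaves only mixed terms \<open>f x * f y\<close>, which the weight \<open>\<omega> x * \<omega> y\<close> controls;
  \<open>\<omega> x * \<omega> y * (f x)\<^sup>2\<close> would not be controlled.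
\<close>

lemma cutoff_energy_le:
  assumes f: "f \<in> l2 \<omega>" "\<Delta> f \<in> l2 \<omega>"
    and \<eta>: "finite {x. \<eta> x \<noteq> 0}" "\<And>x. 0 \<le> \<eta> x" "\<And>x. \<eta> x \<le> 1"
    and lip: "\<And>x y. {x, y} \<in> E \<Longrightarrow> c {x, y} * (\<eta> x - \<eta> y)\<^sup>2 \<le> \<omega> x * \<omega> y"
    and D: "finite D" "\<And>x y. (x, y) \<in> D \<Longrightarrow> {x, y} \<in> E"
  shows "(\<Sum>(x, y)\<in>D. c {x, y} * (\<eta> x * f x - \<eta> y * f y)\<^sup>2)
    \<le> l2_inner \<omega> (\<Delta> f) (\<Delta> f) + real (N + 1) * l2_inner \<omega> f f"
proof -
  \<comment> \<open>Including the endpoints of \<open>D\<close> ensures that \<open>S\<close> sees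
    every edge of \<open>D\<close>, whatever the support of \<eta>. Thus \<open>D\<close> can stay
    fixed while the cutoff varies.\<close>
  define U where "U = {x. \<eta> x \<noteq> 0} \<union> fst ` D \<union> snd ` D"
  define S where "S = U \<union> (\<Union>x\<in>U. neighbours E x)"
  have U: "finite U" using \<eta>(1) D(1) by (simp add: U_def)
  have S: "finite S" "\<And>x. \<eta> x \<noteq> 0 \<Longrightarrow> x \<in> S" "\<And>x. \<eta> x \<noteq> 0 \<Longrightarrow> neighbours E x \<subseteq> S"
    unfolding S_def using U fin_nbr by (fast intro: finite_UnI finite_UN_I, auto simp: U_def)
  have DS: "D \<subseteq> edges_in S"
  proof clarify
    fix x y assume xy: "(x, y) \<in> D"
    then have "x \<in> U" "y \<in> U" by (force simp: U_def)+
    with D(2)[OF xy] show "(x, y) \<in> edges_in S" by (simp add: edges_in_def S_def)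
  qed
  let ?G = "\<lambda>x. (\<eta> x)\<^sup>2 * f x"
  have green': "2 * (\<Sum>x\<in>S. (\<omega> x)\<^sup>2 * \<Delta> f x * ?G x)
      = (\<Sum>(x, y)\<in>edges_in S. c {x, y} * (f x - f y) * (?G x - ?G y))"
    using green[of S ?G f] S by auto
  have nonneg: "0 \<le> c {x, y} * (\<eta> x * f x - \<eta> y * f y)\<^sup>2" if "(x, y) \<in> edges_in S" for x y
    using that c_pos by (auto simp: edges_in_def less_imp_le)
  have "(\<Sum>(x, y)\<in>D. c {x, y} * (\<eta> x * f x - \<eta> y * f y)\<^sup>2)
      \<le> (\<Sum>(x, y)\<in>edges_in S. c {x, y} * (\<eta> x * f x - \<eta> y * f y)\<^sup>2)"
    using nonneg by (intro sum_mono2 finite_edges_in S(1) DS) auto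
  also have "\<dots> \<le> (\<Sum>(x, y)\<in>edges_in S. c {x, y} * (f x - f y) * (?G x - ?G y)
      + ((\<omega> x)\<^sup>2 * (f x)\<^sup>2 / 2 + (\<omega> y)\<^sup>2 * (f y)\<^sup>2 / 2))"
  proof (intro sum_mono, clarify)
    fix x y assume "(x, y) \<in> edges_in S"
    then have xy: "{x, y} \<in> E" by (auto simp: edges_in_def)
    have "c {x, y} * (\<eta> x * f x - \<eta> y * f y)\<^sup>2
        = c {x, y} * (f x - f y) * (?G x - ?G y) + c {x, y} * (\<eta> x - \<eta> y)\<^sup>2 * (f x * f y)"
      by (simp add: algebra_simps power2_eq_square)
    moreover have "c {x, y} * (\<eta> x - \<eta> y)\<^sup>2 * (f x * f y) \<le> (\<omega> x * \<omega> y) * \<bar>f x * f y\<bar>"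
    proof (rule order.trans[OF mult_left_mono[OF abs_ge_self] mult_right_mono[OF lip[OF xy]]])
      show "0 \<le> c {x, y} * (\<eta> x - \<eta> y)\<^sup>2" using c_pos[OF xy] by simp
    qed simp
    moreover have "2 * ((\<omega> x * \<omega> y) * \<bar>f x * f y\<bar>) \<le> (\<omega> x)\<^sup>2 * (f x)\<^sup>2 + (\<omega> y)\<^sup>2 * (f y)\<^sup>2"
      using sum_squares_bound[of "\<omega> x * \<bar>f x\<bar>" "\<omega> y * \<bar>f y\<bar>"]
      by (simp add: power_mult_distrib abs_mult mult_ac)
    ultimately show "c {x, y} * (\<eta> x * f x - \<eta> y * f y)\<^sup>2
      \<le> c {x, y} * (f x - f y) * (?G x - ?G y)
        + ((\<omega> x)\<^sup>2 * (f x)\<^sup>2 / 2 + (\<omega> y)\<^sup>2 * (f y)\<^sup>2 / 2)" by linarith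
  qed
  also have "\<dots> = 2 * (\<Sum>x\<in>S. (\<omega> x)\<^sup>2 * \<Delta> f x * ?G x)
      + ((\<Sum>(x, y)\<in>edges_in S. (\<omega> x)\<^sup>2 * (f x)\<^sup>2) / 2 + (\<Sum>(x, y)\<in>edges_in S. (\<omega> y)\<^sup>2 * (f y)\<^sup>2) / 2)"
    unfolding green' by (simp add: sum.distrib sum_divide_distrib case_prod_unfold)
  also have "(\<Sum>(x, y)\<in>edges_in S. (\<omega> y)\<^sup>2 * (f y)\<^sup>2) = (\<Sum>(x, y)\<in>edges_in S. (\<omega> x)\<^sup>2 * (f x)\<^sup>2)"
    by (rule sum_edges_swap)
  also have "2 * (\<Sum>x\<in>S. (\<omega> x)\<^sup>2 * \<Delta> f x * ?G x)
      \<le> (\<Sum>x\<in>S. (\<omega> x)\<^sup>2 * (\<Delta> f x)\<^sup>2 + (\<omega> x)\<^sup>2 * (f x)\<^sup>2)"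
    unfolding sum_distrib_left
  proof (rule sum_mono)
    fix x
    have "\<Delta> f x * ?G x \<le> (\<eta> x)\<^sup>2 * \<bar>\<Delta> f x * f x\<bar>"
      by (metis abs_ge_self mult.left_commute mult_left_mono zero_le_power2)
    also have "\<dots> \<le> \<bar>\<Delta> f x * f x\<bar>"
      using \<eta>(2,3)[of x] by (intro mult_left_le_one_le) (auto intro: power_le_one)
    also have "2 * \<dots> \<le> (\<Delta> f x)\<^sup>2 + (f x)\<^sup>2"
      using sum_squares_bound[of "\<bar>\<Delta> f x\<bar>" "\<bar>f x\<bar>"] by (simp add: abs_mult)
    finally have "2 * (\<Delta> f x * ?G x) \<le> (\<Delta> f x)\<^sup>2 + (f x)\<^sup>2" by simp
    from mult_left_mono[OF this, of "(\<omega> x)\<^sup>2"]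
    show "2 * ((\<omega> x)\<^sup>2 * \<Delta> f x * ?G x) \<le> (\<omega> x)\<^sup>2 * (\<Delta> f x)\<^sup>2 + (\<omega> x)\<^sup>2 * (f x)\<^sup>2"
      by (simp add: algebra_simps)
  qed
  also have "\<dots> \<le> l2_inner \<omega> (\<Delta> f) (\<Delta> f) + l2_inner \<omega> f f"
    unfolding sum.distrib using f S(1) by (intro add_mono sum_le_l2_inner_self)
  \<comment> \<open>The vertex estimate contributes one copy of
    \<open>l2_inner \<omega> f f\<close>, and the two half-sums over edges contribute
    \<open>N\<close> more.\<close>
  finally show ?thesis
    using sum_edges_vertex_le[OF f(1) S(1)] by (simp add: distrib_right)
qed

text \<open>
  The antisymmetric term is expanded around the endpoint of larger weight \<open>\<omega>\<close>, so that the
  factor \<open>sqrt (\<omega> x * \<omega> y)\<close> coming from the cutoff is absorbed by the function evaluated there.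
\<close>

lemma edge_commutator_le:
  assumes xy: "{x, y} \<in> E" and "0 \<le> \<epsilon>"
    and lip: "c {x, y} * t\<^sup>2 \<le> \<epsilon>\<^sup>2 * (\<omega> x * \<omega> y)"
  shows "\<bar>c {x, y} * t * (f x * g y - g x * f y)\<bar>
    \<le> \<epsilon> / 2 * (c {x, y} * (f x - f y)\<^sup>2 + c {x, y} * (g x - g y)\<^sup>2
      + ((\<omega> x)\<^sup>2 * (f x)\<^sup>2 + (\<omega> x)\<^sup>2 * (g x)\<^sup>2) + ((\<omega> y)\<^sup>2 * (f y)\<^sup>2 + (\<omega> y)\<^sup>2 * (g y)\<^sup>2))"
proof -
  let ?k = "c {x, y}"
  have k: "0 \<le> ?k" using c_pos[OF xy] by simp
  have rest: "0 \<le> \<epsilon> / 2 * ((\<omega> z)\<^sup>2 * (f z)\<^sup>2 + (\<omega> z)\<^sup>2 * (g z)\<^sup>2)" for z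
    using \<open>0 \<le> \<epsilon>\<close> by simp
  show ?thesis
  proof (cases "\<omega> x \<le> \<omega> y")
    case True
    have "\<bar>?k * t * ((f x - f y) * g y)\<bar> \<le> \<epsilon> / 2 * (?k * (f x - f y)\<^sup>2 + (\<omega> y)\<^sup>2 * (g y)\<^sup>2)"
      "\<bar>?k * t * ((g x - g y) * f y)\<bar> \<le> \<epsilon> / 2 * (?k * (g x - g y)\<^sup>2 + (\<omega> y)\<^sup>2 * (f y)\<^sup>2)"
      using weighted_mult_le[OF _ True k \<open>0 \<le> \<epsilon>\<close> lip] \<omega>_pos[of x] by simp_all
    moreover have "?k * t * (f x * g y - g x * f y)
        = ?k * t * ((f x - f y) * g y) - ?k * t * ((g x - g y) * f y)"
      by (simp add: algebra_simps)
    ultimately show ?thesis using rest[of x] unfolding distrib_left by linarith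
  next
    case False
    have "\<bar>?k * t * ((f x - f y) * g x)\<bar> \<le> \<epsilon> / 2 * (?k * (f x - f y)\<^sup>2 + (\<omega> x)\<^sup>2 * (g x)\<^sup>2)"
      "\<bar>?k * t * ((g x - g y) * f x)\<bar> \<le> \<epsilon> / 2 * (?k * (g x - g y)\<^sup>2 + (\<omega> x)\<^sup>2 * (f x)\<^sup>2)"
      using weighted_mult_le[OF _ _ k \<open>0 \<le> \<epsilon>\<close> lip[unfolded mult.commute[of "\<omega> x"]]]
        False \<omega>_pos[of y] by simp_all
    moreover have "?k * t * (f x * g y - g x * f y)
        = ?k * t * ((f x - f y) * g x) - ?k * t * ((g x - g y) * f x)"
      by (simp add: algebra_simps)
    ultimately show ?thesis using rest[of y] unfolding distrib_left by linarith
  qed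
qed

end

subsection \<open>Symmetry of the maximal operator\<close>

locale weighted_graph_cutoffs = weighted_graph +
  fixes \<eta> :: "nat \<Rightarrow> 'a \<Rightarrow> real"
  assumes \<eta>_support: "finite {x. \<eta> n x \<noteq> 0}"
    and \<eta>_nonneg: "0 \<le> \<eta> n x"
    and \<eta>_le_1: "\<eta> n x \<le> 1"
    and \<eta>_tendsto: "(\<lambda>n. \<eta> n x) \<longlonglongrightarrow> 1"
    and \<eta>_edge: "{x, y} \<in> E \<Longrightarrow> c {x, y} * (\<eta> n x - \<eta> n y)\<^sup>2 \<le> (1 / real (Suc n))\<^sup>2 * (\<omega> x * \<omega> y)"
begin

text \<open>The bound of \<open>cutoff_energy_le\<close> is independent of the cutoff, so it
  survives the limit on a fixed finite edge set. It is also independent of \<open>S\<close>, which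
  makes the total energy finite.\<close>

lemma energy_le:
  assumes f: "f \<in> l2 \<omega>" "\<Delta> f \<in> l2 \<omega>" and S: "finite S"
  shows "(\<Sum>(x, y)\<in>edges_in S. c {x, y} * (f x - f y)\<^sup>2)
    \<le> l2_inner \<omega> (\<Delta> f) (\<Delta> f) + real (N + 1) * l2_inner \<omega> f f"
proof (rule LIMSEQ_le_const2)
  show "(\<lambda>n. \<Sum>(x, y)\<in>edges_in S. c {x, y} * (\<eta> n x * f x - \<eta> n y * f y)\<^sup>2)
    \<longlonglongrightarrow> (\<Sum>(x, y)\<in>edges_in S. c {x, y} * (f x - f y)\<^sup>2)"
  proof (rule tendsto_sum, clarify)
    fix x y
    have "(\<lambda>n. c {x, y} * (\<eta> n x * f x - \<eta> n y * f y)\<^sup>2) \<longlonglongrightarrow> c {x, y} * (1 * f x - 1 * f y)\<^sup>2"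
      by (intro tendsto_intros \<eta>_tendsto)
    then show "(\<lambda>n. c {x, y} * (\<eta> n x * f x - \<eta> n y * f y)\<^sup>2) \<longlonglongrightarrow> c {x, y} * (f x - f y)\<^sup>2"
      by simp
  qed
  have lip: "c {x, y} * (\<eta> n x - \<eta> n y)\<^sup>2 \<le> \<omega> x * \<omega> y" if "{x, y} \<in> E" for n x y
  proof (rule order.trans[OF \<eta>_edge[OF that]])
    have "(1 / real (Suc n))\<^sup>2 \<le> 1" by (intro power_le_one) auto
    then show "(1 / real (Suc n))\<^sup>2 * (\<omega> x * \<omega> y) \<le> \<omega> x * \<omega> y"
      using \<omega>_pos[of x] \<omega>_pos[of y] by (intro mult_left_le_one_le) auto
  qed
  show "\<exists>M. \<forall>n\<ge>M. (\<Sum>(x, y)\<in>edges_in S. c {x, y} * (\<eta> n x * f x - \<eta> n y * f y)\<^sup>2)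
      \<le> l2_inner \<omega> (\<Delta> f) (\<Delta> f) + real (N + 1) * l2_inner \<omega> f f"
    by (intro exI allI impI, rule cutoff_energy_le[OF f \<eta>_support \<eta>_nonneg \<eta>_le_1 lip finite_edges_in[OF S]])
      (simp_all add: edges_in_def)
qed

text \<open>The difference of the two pairings is the sum of \<open>h\<close>. Weighted by
  \<open>\<eta> n\<close>, this sum is finite and Green's formula turns it into a commutator of
  order 1 / (n + 1); dominated convergence then removes the weight.\<close>

lemma laplacian_l2_symmetric:
  assumes f: "f \<in> l2 \<omega>" "\<Delta> f \<in> l2 \<omega>" and g: "g \<in> l2 \<omega>" "\<Delta> g \<in> l2 \<omega>"
  shows "l2_inner \<omega> (\<Delta> f) g = l2_inner \<omega> f (\<Delta> g)"
proof -
  define h where "h = (\<lambda>x. (\<omega> x)\<^sup>2 * \<Delta> f x * g x + - ((\<omega> x)\<^sup>2 * f x * \<Delta> g x))"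
  have sums: "(\<lambda>x. (\<omega> x)\<^sup>2 * \<Delta> f x * g x) summable_on UNIV"
    "(\<lambda>x. - ((\<omega> x)\<^sup>2 * f x * \<Delta> g x)) summable_on UNIV"
    using f g by (auto intro: l2_mult_summable simp: summable_on_uminus)
  define K where "K = (\<lambda>f. l2_inner \<omega> (\<Delta> f) (\<Delta> f) + real (N + 1) * l2_inner \<omega> f f)"
  \<comment> \<open>The energies of \<open>f\<close> and \<open>g\<close> are bounded by
    \<open>K\<close>. The factor \<open>2 * real N\<close> arises because vertex terms occur at both
    endpoints of an edge.\<close>
  define C where "C = K f + K g
    + 2 * real N * (l2_inner \<omega> f f + l2_inner \<omega> g g)"
  have bound: "norm (\<Sum>\<^sub>\<infinity>x. \<eta> n x * h x) \<le> C * (1 / real (Suc n))" for n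
  proof -
    define e where "e = 1 / real (Suc n)"
    have "0 \<le> e" by (simp add: e_def)
    obtain S where S: "finite S" "\<And>x. \<eta> n x \<noteq> 0 \<Longrightarrow> x \<in> S"
      "\<And>x. \<eta> n x \<noteq> 0 \<Longrightarrow> neighbours E x \<subseteq> S"
      by (rule finite_neighbourhood[OF \<eta>_support[of n]]) blast
    let ?W = "\<lambda>f x. (\<omega> x)\<^sup>2 * (f x)\<^sup>2"
    have "(\<Sum>\<^sub>\<infinity>x. \<eta> n x * h x) = (\<Sum>\<^sub>\<infinity>x\<in>S. \<eta> n x * h x)"
      using S(2) by (intro infsum_cong_neutral) auto
    also have "\<dots> = (\<Sum>x\<in>S. (\<omega> x)\<^sup>2 * \<Delta> f x * (\<eta> n x * g x))
        - (\<Sum>x\<in>S. (\<omega> x)\<^sup>2 * \<Delta> g x * (\<eta> n x * f x))"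
      using S(1) by (simp add: h_def sum_subtractf[symmetric] algebra_simps)
    also have "\<dots> = (\<Sum>(x, y)\<in>edges_in S. c {x, y} * (f x - f y) * (\<eta> n x * g x - \<eta> n y * g y)) / 2
        - (\<Sum>(x, y)\<in>edges_in S. c {x, y} * (g x - g y) * (\<eta> n x * f x - \<eta> n y * f y)) / 2"
      using S green[of S "\<lambda>x. \<eta> n x * g x" f] green[of S "\<lambda>x. \<eta> n x * f x" g] by simp
    \<comment> \<open>The diagonal products f x * g x and f y * g y cancel between the two sums,
      leaving only the difference of the cutoff times an antisymmetric expression.\<close>
    also have "\<dots> = (\<Sum>(x, y)\<in>edges_in S.
        c {x, y} * (\<eta> n x - \<eta> n y) * (f x * g y - g x * f y)) / 2"
      unfolding diff_divide_distrib[symmetric] sum_subtractf[symmetric]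
      by (intro arg_cong[of _ _ "\<lambda>t. t / 2"] sum.cong) (auto simp: algebra_simps)
    finally have eq: "2 * (\<Sum>\<^sub>\<infinity>x. \<eta> n x * h x)
      = (\<Sum>(x, y)\<in>edges_in S. c {x, y} * (\<eta> n x - \<eta> n y) * (f x * g y - g x * f y))"
      by simp
    have "2 * norm (\<Sum>\<^sub>\<infinity>x. \<eta> n x * h x)
        = \<bar>\<Sum>(x, y)\<in>edges_in S. c {x, y} * (\<eta> n x - \<eta> n y) * (f x * g y - g x * f y)\<bar>"
      unfolding eq[symmetric] by (simp add: abs_mult)
    also have "\<dots> \<le> (\<Sum>(x, y)\<in>edges_in S.
        \<bar>c {x, y} * (\<eta> n x - \<eta> n y) * (f x * g y - g x * f y)\<bar>)"
      using sum_abs[of "\<lambda>(x, y). c {x, y} * (\<eta> n x - \<eta> n y) * (f x * g y - g x * f y)"]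
      by (simp add: case_prod_unfold)
    also have "\<dots> \<le> (\<Sum>(x, y)\<in>edges_in S. e / 2 * (c {x, y} * (f x - f y)\<^sup>2
        + c {x, y} * (g x - g y)\<^sup>2 + (?W f x + ?W g x) + (?W f y + ?W g y)))"
      using edge_commutator_le[OF _ \<open>0 \<le> e\<close> \<eta>_edge[where n = n, folded e_def]] by (intro sum_mono) (auto simp: edges_in_def)
    also have "\<dots> = e / 2 * ((\<Sum>(x, y)\<in>edges_in S. c {x, y} * (f x - f y)\<^sup>2)
        + (\<Sum>(x, y)\<in>edges_in S. c {x, y} * (g x - g y)\<^sup>2)
        + ((\<Sum>(x, y)\<in>edges_in S. ?W f x) + (\<Sum>(x, y)\<in>edges_in S. ?W g x))
        + ((\<Sum>(x, y)\<in>edges_in S. ?W f y) + (\<Sum>(x, y)\<in>edges_in S. ?W g y)))"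
      by (simp only: case_prod_unfold sum.distrib sum_distrib_left[symmetric])
    also have "\<dots> = e / 2 * ((\<Sum>(x, y)\<in>edges_in S. c {x, y} * (f x - f y)\<^sup>2)
        + (\<Sum>(x, y)\<in>edges_in S. c {x, y} * (g x - g y)\<^sup>2)
        + ((\<Sum>(x, y)\<in>edges_in S. ?W f x) + (\<Sum>(x, y)\<in>edges_in S. ?W g x))
        + ((\<Sum>(x, y)\<in>edges_in S. ?W f x) + (\<Sum>(x, y)\<in>edges_in S. ?W g x)))"
      by (simp only: sum_edges_swap[of "\<lambda>x y. ?W f y"] sum_edges_swap[of "\<lambda>x y. ?W g y"])
    also have "\<dots> \<le> e / 2 * C"
    proof (rule mult_left_mono)
      show "(\<Sum>(x, y)\<in>edges_in S. c {x, y} * (f x - f y)\<^sup>2)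
        + (\<Sum>(x, y)\<in>edges_in S. c {x, y} * (g x - g y)\<^sup>2)
        + ((\<Sum>(x, y)\<in>edges_in S. ?W f x) + (\<Sum>(x, y)\<in>edges_in S. ?W g x))
        + ((\<Sum>(x, y)\<in>edges_in S. ?W f x) + (\<Sum>(x, y)\<in>edges_in S. ?W g x)) \<le> C"
        using energy_le[OF f S(1)] energy_le[OF g S(1)]
          sum_edges_vertex_le[OF f(1) S(1)] sum_edges_vertex_le[OF g(1) S(1)]
        unfolding C_def K_def by (simp only: distrib_left mult.assoc)
    qed (use \<open>0 \<le> e\<close> in simp)
    finally have "2 * norm (\<Sum>\<^sub>\<infinity>x. \<eta> n x * h x) \<le> e * C / 2" by simp
    moreover have "0 \<le> e * C"
      unfolding C_def K_def using \<open>0 \<le> e\<close>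
      by (intro mult_nonneg_nonneg add_nonneg_nonneg l2_inner_self_nonneg) auto
    ultimately have "norm (\<Sum>\<^sub>\<infinity>x. \<eta> n x * h x) \<le> e * C" by linarith
    then show ?thesis by (simp add: e_def mult.commute)
  qed
  have "(\<lambda>n. C * (1 / real (Suc n))) \<longlonglongrightarrow> C * 0"
    by (intro tendsto_intros LIMSEQ_Suc[OF lim_const_over_n])
  then have "(\<lambda>n. C * (1 / real (Suc n))) \<longlonglongrightarrow> 0" by simp
  with always_eventually[OF allI[OF bound]]
  have "(\<lambda>n. \<Sum>\<^sub>\<infinity>x. \<eta> n x * h x) \<longlonglongrightarrow> 0" by (rule Lim_null_comparison)
  moreover have "(\<lambda>n. \<Sum>\<^sub>\<infinity>x. \<eta> n x * h x) \<longlonglongrightarrow> (\<Sum>\<^sub>\<infinity>x. h x)"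
    unfolding h_def using sums
    by (intro infsum_mult_tendsto \<eta>_nonneg \<eta>_le_1 \<eta>_tendsto summable_on_add)
  ultimately have "(\<Sum>\<^sub>\<infinity>x. h x) = 0" by (rule LIMSEQ_unique[symmetric])
  moreover have "(\<Sum>\<^sub>\<infinity>x. h x) = l2_inner \<omega> (\<Delta> f) g - l2_inner \<omega> f (\<Delta> g)"
    unfolding h_def l2_inner_def by (subst infsum_add[OF sums]) (simp add: infsum_uminus)
  ultimately show ?thesis by simp
qed

end

subsection \<open>Self-adjoint extensions\<close>

text \<open>The smaller operator offers fewer test functions, on which both operators agree.\<close>

lemma is_adjoint_value_antimono:
  assumes "is_adjoint_value \<omega> B g h" "A \<subseteq>\<^sub>m B"
  shows "is_adjoint_value \<omega> A g h"
  using assms unfolding is_adjoint_value_def map_le_def by (metis domIff)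

section \<open>Minimal and maximal Laplacian, and adjoints of extensions\<close>

context weighted_graph
begin

definition max_laplacian :: "'v operator" where
  "max_laplacian = (\<lambda>g. if g \<in> l2 \<omega> \<and> \<Delta> g \<in> l2 \<omega> then Some (\<Delta> g) else None)"

lemma laplacian_C0_eq: "laplacian_C0 E \<omega> c f = (if f \<in> C0 then Some (\<Delta> f) else None)"
  by (simp add: laplacian_C0_def restrict_map_def)

lemma dom_laplacian_C0: "dom (laplacian_C0 E \<omega> c) = C0"
  by (auto simp: laplacian_C0_eq dom_def)

lemma the_laplacian_C0: "f \<in> C0 \<Longrightarrow> the (laplacian_C0 E \<omega> c f) = \<Delta> f"
  by (simp add: laplacian_C0_eq)

lemma laplacian_C0_le_max: "laplacian_C0 E \<omega> c \<subseteq>\<^sub>m max_laplacian"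
  using laplacian_in_C0 C0_subset_l2
  by (auto simp: map_le_def dom_laplacian_C0 laplacian_C0_eq max_laplacian_def)

lemma laplacian_zero: "\<Delta> (\<lambda>x. 0) = (\<lambda>x. 0)"
  by (simp add: laplacian_def)

lemma laplacian_add: "\<Delta> (\<lambda>x. f x + g x) = (\<lambda>x. \<Delta> f x + \<Delta> g x)"
  unfolding laplacian_def distrib_left[symmetric] sum.distrib[symmetric]
  by (intro ext arg_cong2[of _ _ _ _ "(*)"] sum.cong) (auto simp: algebra_simps)

lemma laplacian_scale: "\<Delta> (\<lambda>x. r * f x) = (\<lambda>x. r * \<Delta> f x)"
  by (simp add: laplacian_def sum_distrib_left algebra_simps)

lemma C0_zero: "(\<lambda>x. 0) \<in> C0"
  by (simp add: C0_def)

lemma C0_add: "f \<in> C0 \<Longrightarrow> g \<in> C0 \<Longrightarrow> (\<lambda>x. f x + g x) \<in> C0"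
  unfolding C0_def by (auto intro: finite_subset[of _ "{x. f x \<noteq> 0} \<union> {x. g x \<noteq> 0}"])

lemma C0_scale: "f \<in> C0 \<Longrightarrow> (\<lambda>x. r * f x) \<in> C0"
  unfolding C0_def by (auto intro: finite_subset[of _ "{x. f x \<noteq> 0}"])

lemma linear_laplacian_C0: "linear_operator \<omega> (laplacian_C0 E \<omega> c)"
  using laplacian_in_C0 C0_subset_l2[of \<omega>]
  by (auto simp: linear_operator_def dom_laplacian_C0 ran_def laplacian_C0_eq C0_zero
      laplacian_zero laplacian_add laplacian_scale C0_add C0_scale split: if_splits)

lemma linear_max_laplacian: "linear_operator \<omega> max_laplacian"
  using C0_zero C0_subset_l2[of \<omega>]
  by (auto simp: linear_operator_def dom_def ran_def max_laplacian_def
      laplacian_zero laplacian_add laplacian_scale l2_add l2_scale split: if_splits)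

lemma symmetric_laplacian_C0: "symmetric_operator \<omega> (laplacian_C0 E \<omega> c)"
  unfolding symmetric_operator_def
proof (intro conjI ballI linear_laplacian_C0)
  show "densely_defined \<omega> (laplacian_C0 E \<omega> c)"
    unfolding densely_defined_def dom_laplacian_C0 by (metis C0_dense_l2)
qed (auto simp: dom_laplacian_C0 the_laplacian_C0 laplacian_C0_symmetric)

lemma densely_defined_max_laplacian: "densely_defined \<omega> max_laplacian"
  using symmetric_laplacian_C0 map_le_implies_dom_le[OF laplacian_C0_le_max]
  unfolding symmetric_operator_def densely_defined_def by blast

text \<open>Testing against point masses forces \<open>h\<close> to agree with \<Delta> g at every
  vertex, since the weights are positive. The converse is
  \<open>laplacian_C0_symmetric\<close>.\<close>

lemma adjoint_value_laplacian_C0: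
  "is_adjoint_value \<omega> (laplacian_C0 E \<omega> c) g h \<longleftrightarrow> h \<in> l2 \<omega> \<and> h = \<Delta> g"
proof
  assume h: "is_adjoint_value \<omega> (laplacian_C0 E \<omega> c) g h"
  have "h x = \<Delta> g x" for x
  proof -
    define \<delta> :: "'v \<Rightarrow> real" where "\<delta> = (\<lambda>y. if y = x then 1 else 0)"
    have \<delta>: "\<delta> \<in> C0" by (simp add: \<delta>_def C0_def)
    have "l2_inner \<omega> k \<delta> = (\<omega> x)\<^sup>2 * k x" for k
      using l2_inner_eq_sum[of "{x}" \<delta> \<omega> k] by (simp add: \<delta>_def)
    moreover have "l2_inner \<omega> h \<delta> = l2_inner \<omega> (\<Delta> g) \<delta>"
      using h \<delta> laplacian_C0_symmetric[OF \<delta>, of g]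
      by (simp add: is_adjoint_value_def dom_laplacian_C0 the_laplacian_C0 l2_inner_commute[of _ _ \<delta>])
    ultimately show ?thesis using \<omega>_pos[of x] by simp
  qed
  with h show "h \<in> l2 \<omega> \<and> h = \<Delta> g" by (auto simp: is_adjoint_value_def)
qed (auto simp: is_adjoint_value_def dom_laplacian_C0 the_laplacian_C0 laplacian_C0_symmetric)

lemma adjoint_value_extension:
  assumes "laplacian_C0 E \<omega> c \<subseteq>\<^sub>m B" "is_adjoint_value \<omega> B g h"
  shows "h = \<Delta> g" "\<Delta> g \<in> l2 \<omega>"
  using is_adjoint_value_antimono[OF assms(2,1)] unfolding adjoint_value_laplacian_C0 by auto

text \<open>For any extension \<open>B\<close> the adjoint value can only be \<Delta> g. This
  resolves the description operator and leaves only the domain of the adjoint dependent on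
  \<open>B\<close>.\<close>

lemma adjoint_extension:
  assumes "laplacian_C0 E \<omega> c \<subseteq>\<^sub>m B"
  shows "adjoint_operator \<omega> B g
    = (if g \<in> l2 \<omega> \<and> is_adjoint_value \<omega> B g (\<Delta> g) then Some (\<Delta> g) else None)"
proof -
  have ex: "(\<exists>h. is_adjoint_value \<omega> B g h) \<longleftrightarrow> is_adjoint_value \<omega> B g (\<Delta> g)"
    by (auto dest: adjoint_value_extension(1)[OF assms])
  have the: "(THE h. is_adjoint_value \<omega> B g h) = \<Delta> g" if "is_adjoint_value \<omega> B g (\<Delta> g)"
    by (rule the_equality, rule that) (rule adjoint_value_extension(1)[OF assms])
  show ?thesis unfolding adjoint_operator_def ex using the by auto
qed

text \<open>Such a \<open>B\<close> equals its adjoint, which acts as \<Delta> and takes values in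
  \<open>l2 \<omega>\<close>.\<close>

lemma self_adjoint_extension_le_max:
  assumes "laplacian_C0 E \<omega> c \<subseteq>\<^sub>m B" "self_adjoint \<omega> B"
  shows "B \<subseteq>\<^sub>m max_laplacian"
proof -
  have "B g = (if g \<in> l2 \<omega> \<and> is_adjoint_value \<omega> B g (\<Delta> g) then Some (\<Delta> g) else None)" for g
    using assms(2) adjoint_extension[OF assms(1), of g] by (simp add: self_adjoint_def)
  then show ?thesis
    by (auto simp: map_le_def dom_def max_laplacian_def dest: adjoint_value_extension(2)[OF assms(1)]
        split: if_splits)
qed

text \<open>
  Every self-adjoint extension of the minimal operator lies below the maximal one, and symmetry of
  the maximal operator forces the converse inclusion.
\<close>

lemma essentially_self_adjointI:
  assumes sym: "\<And>f g. f \<in> l2 \<omega> \<Longrightarrow> \<Delta> f \<in> l2 \<omega> \<Longrightarrow> g \<in> l2 \<omega> \<Longrightarrow> \<Delta> g \<in> l2 \<omega>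
    \<Longrightarrow> l2_inner \<omega> (\<Delta> f) g = l2_inner \<omega> f (\<Delta> g)"
  shows "essentially_self_adjoint \<omega> (laplacian_C0 E \<omega> c)"
  unfolding essentially_self_adjoint_def
proof (intro conjI symmetric_laplacian_C0 ex1I)
  \<comment> \<open>The symmetry hypothesis places the maximal operator inside its own
    adjoint.\<close>
  have max: "is_adjoint_value \<omega> max_laplacian g (\<Delta> g)" if "g \<in> l2 \<omega>" "\<Delta> g \<in> l2 \<omega>" for g
    unfolding is_adjoint_value_def
  proof (intro conjI ballI that)
    fix f assume "f \<in> dom max_laplacian"
    then have "f \<in> l2 \<omega>" "\<Delta> f \<in> l2 \<omega>"
      by (auto simp: max_laplacian_def dom_def split: if_splits)
    with sym[OF _ _ that] show "l2_inner \<omega> (the (max_laplacian f)) g = l2_inner \<omega> f (\<Delta> g)"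
      by (simp add: max_laplacian_def)
  qed
  have "adjoint_operator \<omega> max_laplacian = max_laplacian"
  proof
    fix g
    have "is_adjoint_value \<omega> max_laplacian g (\<Delta> g) \<longleftrightarrow> \<Delta> g \<in> l2 \<omega>" if "g \<in> l2 \<omega>"
      using max[OF that] adjoint_value_extension(2)[OF laplacian_C0_le_max] by metis
    moreover have "max_laplacian g = (if g \<in> l2 \<omega> \<and> \<Delta> g \<in> l2 \<omega> then Some (\<Delta> g) else None)"
      by (simp add: max_laplacian_def)
    ultimately show "adjoint_operator \<omega> max_laplacian g = max_laplacian g"
      unfolding adjoint_extension[OF laplacian_C0_le_max] by auto
  qed
  then show "self_adjoint \<omega> max_laplacian"
    by (simp add: self_adjoint_def linear_max_laplacian densely_defined_max_laplacian)
  show "laplacian_C0 E \<omega> c \<subseteq>\<^sub>m max_laplacian" by (rule laplacian_C0_le_max)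
  fix B assume B: "self_adjoint \<omega> B \<and> laplacian_C0 E \<omega> c \<subseteq>\<^sub>m B"
  then have le: "B \<subseteq>\<^sub>m max_laplacian" by (blast intro: self_adjoint_extension_le_max)
  \<comment> \<open>Adjoints reverse the inclusion \<open>le\<close>: an adjoint value for the
    maximal operator is one for \<open>B\<close>, and \<open>B\<close> is its own adjoint.\<close>
  have "max_laplacian \<subseteq>\<^sub>m B"
    unfolding map_le_def
  proof
    fix g assume "g \<in> dom max_laplacian"
    then have g: "g \<in> l2 \<omega>" "\<Delta> g \<in> l2 \<omega>"
      by (auto simp: max_laplacian_def dom_def split: if_splits)
    then have "is_adjoint_value \<omega> B g (\<Delta> g)"
      by (rule is_adjoint_value_antimono[OF max le])
    with g B have "B g = Some (\<Delta> g)"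
      using adjoint_extension[of B g] by (simp add: self_adjoint_def)
    with g show "max_laplacian g = B g" by (simp add: max_laplacian_def)
  qed
  with le show "B = max_laplacian" by (rule map_le_antisym)
qed

end

theorem theorem6p2:
  fixes E :: "'v set set"
    and \<omega> :: "'v \<Rightarrow> real"
    and c a :: "'v set \<Rightarrow> real"
  assumes "infinite (UNIV :: 'v set)"
    and "simple_graph E"
    and "connected_graph E"
    and "locally_finite E"
    and "bounded_degree E"
    and "\<forall>x. \<omega> x > 0"
    and "\<forall>e\<in>E. c e > 0"
    and "\<forall>x y. {x, y} \<in> E \<longrightarrow> a {x, y} = c {x, y} / (\<omega> x * \<omega> y)"
    and "Metric_space.mcomplete UNIV (weighted_dist E a)"
  shows "essentially_self_adjoint \<omega> (laplacian_C0 E \<omega> c)"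
proof -
  obtain N where N: "\<And>x. finite (neighbours E x)" "\<And>x. card (neighbours E x) \<le> N"
    using assms(5) by (auto simp: bounded_degree_def)
  have a_pos: "\<forall>e\<in>E. a e > 0"
  proof
    fix e assume e: "e \<in> E"
    then obtain x y where "e = {x, y}" using assms(2) by (auto simp: simple_graph_def)
    with e assms(6,7,8) show "a e > 0" by simp
  qed
  obtain x0 :: 'v where True by simp
  interpret weighted_graph_cutoffs E \<omega> c N "cutoff E a x0"
  proof
    fix x y n assume xy: "{x, y} \<in> E"
    have "\<omega> x \<noteq> 0" "\<omega> y \<noteq> 0"
      using assms(6)[rule_format, of x] assms(6)[rule_format, of y] by simp_all
    \<comment> \<open>The choice of \<open>a\<close> converts the Lipschitz bound for the distance
      into the cutoff bound with weight \<omega> x * \<omega> y.\<close>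
    then have "c {x, y} = a {x, y} * (\<omega> x * \<omega> y)"
      using assms(8)[rule_format, OF xy] by simp
    then have "c {x, y} * (cutoff E a x0 n x - cutoff E a x0 n y)\<^sup>2
        = a {x, y} * (cutoff E a x0 n x - cutoff E a x0 n y)\<^sup>2 * (\<omega> x * \<omega> y)" by simp
    also have "\<dots> \<le> (1 / real (Suc n))\<^sup>2 * (\<omega> x * \<omega> y)"
      using assms(6) cutoff_edge[OF assms(2,4,3) a_pos xy]
      by (intro mult_right_mono) (auto simp: less_imp_le)
    finally show "c {x, y} * (cutoff E a x0 n x - cutoff E a x0 n y)\<^sup>2
        \<le> (1 / real (Suc n))\<^sup>2 * (\<omega> x * \<omega> y)" .
  qed (assumption | rule N assms(6)[rule_format] assms(7)[rule_format]
      cutoff_finite_support[OF assms(2,4,3) a_pos assms(9)] cutoff_nonneg[OF assms(2,4,3) a_pos]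
      cutoff_le_1[OF assms(2,4,3) a_pos] cutoff_tendsto[OF assms(2,4,3) a_pos])+
  show ?thesis by (rule essentially_self_adjointI[OF laplacian_l2_symmetric])
qed

end
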